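(* Let $K : V \to V$ be a linear, self-adjoint, positive definite operator, $C = K^{-1}$, and let $D : H \to V$ be the grid operator with adjoint $D^* : V \to H$ and components $D_\alpha^\pm$ defined in the context. Put \[ R = D D^*, \qquad Q = \mathrm{diag}\bigl( D_1^+ (D_1^+)^*, \; D_1^- (D_1^-)^*, \; D_2^+ (D_2^+)^*, \; D_2^- (D_2^-)^* \bigr), \] so that $Q$ is the (block) diagonal part of $R$ as an operator on $V$. Let $u^0 \in H$, let $N \ge 1$ be an integer, $\tau > 0$, and let $\varphi^0, \dots, \varphi^{N-1} \in H$. Consider the difference scheme with weight $\sigma \in \mathbb{R}$ for $\mathbf{g}^0, \dots, \mathbf{g}^N \in V$: \[ C \frac{\mathbf{g}^{n+1} - \mathbf{g}^{n}}{\tau} + Q \bigl( \sigma \mathbf{g}^{n+1} + (1-\sigma) \mathbf{g}^{n} \bigr) + (R - Q) \mathbf{g}^{n} = D \varphi^n, \quad n = 0,1,\dots,N-1, \qquad \mathbf{g}^0 = K D u^0 . \] If $\sigma \ge 2$, then the scheme is unconditionally stable: for every $\tau > 0$ (with no restriction relating $\tau$ to the grid steps), the operator \[ B = C + \sigma \tau Q - \frac{\tau}{2} R \] is self-adjoint and positive definite (so that $\|\cdot\|_B$ and $\|\cdot\|_{B^{-1}}$ are norms), and the solution of the scheme satisfies \[ \|\mathbf{g}^{n+1}\|_B \le \|\mathbf{g}^{n}\|_B + \tau \| D \varphi^n \|_{B^{-1}}, \quad n = 0,1,\dots,N-1 . \]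
   Context: Grid. Let $l_1, l_2 > 0$, let $N_1, N_2$ be positive integers and $h_\alpha = l_\alpha / N_\alpha$, $\alpha = 1,2$. Let $\overline{\omega} = \{ (i_1 h_1, i_2 h_2) : i_\alpha = 0,1,\dots,N_\alpha,\ \alpha = 1,2 \}$, let $\omega$ be its set of interior nodes ($1 \le i_\alpha \le N_\alpha - 1$), and $\partial\omega = \overline{\omega} \setminus \omega$. $H$ is the finite-dimensional real Hilbert space of grid functions $y$ on $\overline{\omega}$ with $y = 0$ on $\partial \omega$, with scalar product $(y,w) = \sum_{\bm{x} \in \omega} y(\bm{x}) w(\bm{x}) h_1 h_2$. Define the subgrids of points $(i_1 h_1, i_2 h_2)$: $\omega_1^+$: $0 \le i_1 \le N_1 - 1$, $1 \le i_2 \le N_2 - 1$; $\omega_1^-$: $1 \le i_1 \le N_1$, $1 \le i_2 \le N_2 - 1$; $\omega_2^+$: $1 \le i_1 \le N_1 - 1$, $0 \le i_2 \le N_2 - 1$; $\omega_2^-$: $1 \le i_1 \le N_1 - 1$, $1 \le i_2 \le N_2$. $H_\alpha^\pm$ is the space of real functions on $\omega_\alpha^\pm$ with scalar product $(y,w)_\alpha^\pm = \sum_{\bm{x} \in \omega_\alpha^\pm} y(\bm{x}) w(\bm{x}) h_1 h_2$. The space of grid vector functions is $V = H_1^+ \oplus H_1^- \oplus H_2^+ \oplus H_2^-$, with elements $\mathbf{q} = (q_1^+, q_1^-, q_2^+, q_2^-)^T$ and scalar product $(\mathbf{q}, \mathbf{g}) = \sum_{\alpha=1}^{2} \bigl(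 (q_\alpha^+, g_\alpha^+)_\alpha^+ + (q_\alpha^-, g_\alpha^-)_\alpha^- \bigr)$. Operators. With $e_\alpha$ the unit coordinate vector in direction $\alpha$, define $D_\alpha^\pm : H \to H_\alpha^\pm$ by $(D_\alpha^+ y)(\bm{x}) = - \dfrac{y(\bm{x} + h_\alpha e_\alpha) - y(\bm{x})}{h_\alpha}$ for $\bm{x} \in \omega_\alpha^+$, and $(D_\alpha^- y)(\bm{x}) = - \dfrac{y(\bm{x}) - y(\bm{x} - h_\alpha e_\alpha)}{h_\alpha}$ for $\bm{x} \in \omega_\alpha^-$. Set $D = (D_1^+, D_1^-, D_2^+, D_2^-)^T : H \to V$; $D^* = ((D_1^+)^*, (D_1^-)^*, (D_2^+)^*, (D_2^-)^* ) : V \to H$ is its adjoint. Norms. For a self-adjoint positive definite operator $S$ on $V$, $\|\mathbf{q}\|_S = (S \mathbf{q}, \mathbf{q})^{1/2}$. *)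

theory Defs
  imports Complex_Main "HOL-Library.Function_Algebras"
begin

text \<open>Pointwise scaling, so that grid functions are vectors of the type class; addition on
  functions is that of \<^theory>\<open>HOL-Library.Function_Algebras\<close>.\<close>

instantiation "fun" :: (type, real_vector) real_vector
begin

definition scaleR_fun :: "real \<Rightarrow> ('a \<Rightarrow> 'b) \<Rightarrow> 'a \<Rightarrow> 'b"
  where "scaleR_fun a f = (\<lambda>x. a *\<^sub>R f x)"

instance
  by standard (auto simp: scaleR_fun_def fun_eq_iff algebra_simps)

end

text \<open>A space is a carrier \<open>X\<close> inside a real vector type together with a scalar
  product \<open>ip\<close>. Values of operators outside the carrier are irrelevant.\<close>

definition linear_operator_on :: "'a::real_vector set \<Rightarrow> ('a \<Rightarrow> 'a) \<Rightarrow> bool"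
  where "linear_operator_on X S \<longleftrightarrow>
    (\<forall>x\<in>X. S x \<in> X) \<and>
    (\<forall>x\<in>X. \<forall>y\<in>X. S (x + y) = S x + S y) \<and>
    (\<forall>a. \<forall>x\<in>X. S (a *\<^sub>R x) = a *\<^sub>R S x)"

definition self_adjoint_on :: "'a::real_vector set \<Rightarrow> ('a \<Rightarrow> 'a \<Rightarrow> real) \<Rightarrow> ('a \<Rightarrow> 'a) \<Rightarrow> bool"
  where "self_adjoint_on X ip S \<longleftrightarrow> (\<forall>x\<in>X. \<forall>y\<in>X. ip (S x) y = ip x (S y))"

definition positive_definite_on :: "'a::real_vector set \<Rightarrow> ('a \<Rightarrow> 'a \<Rightarrow> real) \<Rightarrow> ('a \<Rightarrow> 'a) \<Rightarrow> bool"
  where "positive_definite_on X ip S \<longleftrightarrow> (\<forall>x\<in>X. x \<noteq> 0 \<longrightarrow> ip (S x) x > 0)"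

definition norm_on :: "'a::real_vector set \<Rightarrow> ('a \<Rightarrow> real) \<Rightarrow> bool"
  where "norm_on X \<nu> \<longleftrightarrow>
    (\<forall>x\<in>X. 0 \<le> \<nu> x \<and> (\<nu> x = 0 \<longleftrightarrow> x = 0)) \<and>
    (\<forall>a. \<forall>x\<in>X. \<nu> (a *\<^sub>R x) = \<bar>a\<bar> * \<nu> x) \<and>
    (\<forall>x\<in>X. \<forall>y\<in>X. \<nu> (x + y) \<le> \<nu> x + \<nu> y)"

text \<open>The adjoint of \<open>A : X \<rightarrow> Y\<close>: its value at \<open>q\<close> is the unique \<open>w \<in> X\<close> with
  \<open>(A y, q)\<^sub>Y = (y, w)\<^sub>X\<close> for all \<open>y \<in> X\<close>. It exists and is unique for the finite-dimensional
  spaces below, so the description operator is only used where it is meaningful.\<close>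

definition adjoint_on ::
  "'a set \<Rightarrow> ('a \<Rightarrow> 'a \<Rightarrow> real) \<Rightarrow> ('b \<Rightarrow> 'b \<Rightarrow> real) \<Rightarrow> ('a \<Rightarrow> 'b) \<Rightarrow> 'b \<Rightarrow> 'a"
  where "adjoint_on X ipX ipY A q = (THE w. w \<in> X \<and> (\<forall>y\<in>X. ipY (A y) q = ipX y w))"

text \<open>The node \<open>(i\<^sub>1 h\<^sub>1, i\<^sub>2 h\<^sub>2)\<close> is represented by its index \<open>(i\<^sub>1, i\<^sub>2)\<close>, and a function on a
  set of nodes by its extension by zero.\<close>

type_synonym node = "nat \<times> nat"

record grid =
  len1 :: real
  len2 :: real
  num1 :: nat
  num2 :: nat

definition h1 :: "grid \<Rightarrow> real" where "h1 G = len1 G / real (num1 G)"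
definition h2 :: "grid \<Rightarrow> real" where "h2 G = len2 G / real (num2 G)"

definition nodes :: "grid \<Rightarrow> node set"
  where "nodes G = {0..num1 G} \<times> {0..num2 G}"

definition interior_nodes :: "grid \<Rightarrow> node set"
  where "interior_nodes G = {1..num1 G - 1} \<times> {1..num2 G - 1}"

definition boundary_nodes :: "grid \<Rightarrow> node set"
  where "boundary_nodes G = nodes G - interior_nodes G"

definition functions_on :: "node set \<Rightarrow> (node \<Rightarrow> real) set"
  where "functions_on S = {y. \<forall>x. x \<notin> S \<longrightarrow> y x = 0}"

definition inner_on :: "grid \<Rightarrow> node set \<Rightarrow> (node \<Rightarrow> real) \<Rightarrow> (node \<Rightarrow> real) \<Rightarrow> real"
  where "inner_on G S y w = (\<Sum>x\<in>S. y x * w x * h1 G * h2 G)"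

definition H :: "grid \<Rightarrow> (node \<Rightarrow> real) set"
  where "H G = {y \<in> functions_on (nodes G). \<forall>x\<in>boundary_nodes G. y x = 0}"

definition inner_H :: "grid \<Rightarrow> (node \<Rightarrow> real) \<Rightarrow> (node \<Rightarrow> real) \<Rightarrow> real"
  where "inner_H G = inner_on G (interior_nodes G)"

text \<open>\<open>P\<alpha>\<close> and \<open>M\<alpha>\<close> label the components with superscript \<open>+\<close> and \<open>-\<close> in direction \<open>\<alpha>\<close>.\<close>

datatype component = P1 | M1 | P2 | M2

fun subgrid :: "grid \<Rightarrow> component \<Rightarrow> node set" where
  "subgrid G P1 = {0..num1 G - 1} \<times> {1..num2 G - 1}"
| "subgrid G M1 = {1..num1 G} \<times> {1..num2 G - 1}"
| "subgrid G P2 = {1..num1 G - 1} \<times> {0..num2 G - 1}"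
| "subgrid G M2 = {1..num1 G - 1} \<times> {1..num2 G}"

type_synonym vector_function = "component \<Rightarrow> node \<Rightarrow> real"

definition V :: "grid \<Rightarrow> vector_function set"
  where "V G = {q. \<forall>c. q c \<in> functions_on (subgrid G c)}"

definition inner_V :: "grid \<Rightarrow> vector_function \<Rightarrow> vector_function \<Rightarrow> real"
  where "inner_V G q g = (\<Sum>c\<in>{P1, M1, P2, M2}. inner_on G (subgrid G c) (q c) (g c))"

fun difference :: "grid \<Rightarrow> component \<Rightarrow> (node \<Rightarrow> real) \<Rightarrow> node \<Rightarrow> real" where
  "difference G P1 y (i, j) = - ((y (i + 1, j) - y (i, j)) / h1 G)"
| "difference G M1 y (i, j) = - ((y (i, j) - y (i - 1, j)) / h1 G)"
| "difference G P2 y (i, j) = - ((y (i, j + 1) - y (i, j)) / h2 G)"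
| "difference G M2 y (i, j) = - ((y (i, j) - y (i, j - 1)) / h2 G)"

definition D_comp :: "grid \<Rightarrow> component \<Rightarrow> (node \<Rightarrow> real) \<Rightarrow> node \<Rightarrow> real"
  where "D_comp G c y = (\<lambda>x. if x \<in> subgrid G c then difference G c y x else 0)"

definition D_comp_adj :: "grid \<Rightarrow> component \<Rightarrow> (node \<Rightarrow> real) \<Rightarrow> node \<Rightarrow> real"
  where "D_comp_adj G c =
    adjoint_on (H G) (inner_H G) (inner_on G (subgrid G c)) (D_comp G c)"

definition D :: "grid \<Rightarrow> (node \<Rightarrow> real) \<Rightarrow> vector_function"
  where "D G y = (\<lambda>c. D_comp G c y)"

definition D_adj :: "grid \<Rightarrow> vector_function \<Rightarrow> node \<Rightarrow> real"
  where "D_adj G = adjoint_on (H G) (inner_H G) (inner_V G) (D G)"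

definition R :: "grid \<Rightarrow> vector_function \<Rightarrow> vector_function"
  where "R G q = D G (D_adj G q)"

definition Q :: "grid \<Rightarrow> vector_function \<Rightarrow> vector_function"
  where "Q G q = (\<lambda>c. D_comp G c (D_comp_adj G c (q c)))"

definition self_adjoint_pos_def :: "grid \<Rightarrow> (vector_function \<Rightarrow> vector_function) \<Rightarrow> bool"
  where "self_adjoint_pos_def G S \<longleftrightarrow>
    linear_operator_on (V G) S \<and>
    self_adjoint_on (V G) (inner_V G) S \<and>
    positive_definite_on (V G) (inner_V G) S"

definition inverse_op ::
  "grid \<Rightarrow> (vector_function \<Rightarrow> vector_function) \<Rightarrow> vector_function \<Rightarrow> vector_function"
  where "inverse_op G S = inv_into (V G) S"

definition op_norm ::
  "grid \<Rightarrow> (vector_function \<Rightarrow> vector_function) \<Rightarrow> vector_function \<Rightarrow> real"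
  where "op_norm G S q = sqrt (inner_V G (S q) q)"

definition B_op :: "grid \<Rightarrow> (vector_function \<Rightarrow> vector_function) \<Rightarrow> real \<Rightarrow> real \<Rightarrow>
    vector_function \<Rightarrow> vector_function"
  where "B_op G C \<sigma> \<tau> q = C q + (\<sigma> * \<tau>) *\<^sub>R Q G q - (\<tau> / 2) *\<^sub>R R G q"

definition scheme_solution :: "grid \<Rightarrow> (vector_function \<Rightarrow> vector_function) \<Rightarrow> real \<Rightarrow> real \<Rightarrow> nat \<Rightarrow>
    (node \<Rightarrow> real) \<Rightarrow> (nat \<Rightarrow> node \<Rightarrow> real) \<Rightarrow> (nat \<Rightarrow> vector_function) \<Rightarrow> bool"
  where "scheme_solution G K \<sigma> \<tau> N u0 \<phi> g \<longleftrightarrow>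
    (\<forall>n\<le>N. g n \<in> V G) \<and>
    g 0 = K (D G u0) \<and>
    (\<forall>n<N. inverse_op G K ((1 / \<tau>) *\<^sub>R (g (n + 1) - g n))
            + Q G (\<sigma> *\<^sub>R g (n + 1) + (1 - \<sigma>) *\<^sub>R g n)
            + (R G (g n) - Q G (g n))
          = D G (\<phi> n))"

end

theory Submission
  imports Defs
begin

text \<open>Since \<open>D\<^sup>* q\<close> is the sum of the four functions \<open>D\<^sub>c\<^sup>* q\<^sub>c\<close>, the inequality
  \<open>(a\<^sub>1 + a\<^sub>2 + a\<^sub>3 + a\<^sub>4)\<^sup>2 \<le> 4 (a\<^sub>1\<^sup>2 + a\<^sub>2\<^sup>2 + a\<^sub>3\<^sup>2 + a\<^sub>4\<^sup>2)\<close> gives \<open>R \<le> 4 Q\<close>, so that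
  \<open>B \<ge> C > 0\<close> for \<open>\<sigma> \<ge> 2\<close>. The scheme has the form
  \<open>B (g\<^sup>n\<^sup>+\<^sup>1 - g\<^sup>n) + (\<tau> / 2) R (g\<^sup>n\<^sup>+\<^sup>1 + g\<^sup>n) = \<tau> D \<phi>\<^sup>n\<close>; its scalar product with
  \<open>g\<^sup>n\<^sup>+\<^sup>1 + g\<^sup>n\<close> bounds \<open>\<parallel>g\<^sup>n\<^sup>+\<^sup>1\<parallel>\<^sub>B\<^sup>2 - \<parallel>g\<^sup>n\<parallel>\<^sub>B\<^sup>2\<close> by
  \<open>\<tau> \<parallel>D \<phi>\<^sup>n\<parallel> (\<parallel>g\<^sup>n\<^sup>+\<^sup>1\<parallel>\<^sub>B + \<parallel>g\<^sup>n\<parallel>\<^sub>B)\<close>, where \<open>D \<phi>\<^sup>n\<close> is measured in the norm of \<open>B\<^sup>-\<^sup>1\<close>.\<close>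

section \<open>Positive definite operators on finite-dimensional subspaces\<close>

text \<open>\<open>S\<close> is linear only on the carrier, so it is replaced by a map
  \<open>L\<close>, linear on the whole type, that agrees with it on a basis \<open>E\<close> of
  \<open>X\<close>. Dimension counting for \<open>L\<close> then gives surjectivity.\<close>

lemma linear_operator_on_inj_imp_surj:
  fixes X :: "'a::real_vector set"
  assumes X: "subspace X" and T: "finite T" "X \<subseteq> span T"
    and lin: "linear_operator_on X S" and inj: "inj_on S X"
  shows "S ` X = X"
proof
  show "S ` X \<subseteq> X"
    using lin by (auto simp: linear_operator_on_def)
next
  obtain E where E: "E \<subseteq> X" "independent E" "X \<subseteq> span E"
    using real_vector.maximal_independent_subset by blast
  have "finite E"
    using real_vector.independent_span_bound[OF T(1) E(2)] E(1) T(2) by blast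
  have spanE: "span E = X"
    using E span_minimal[OF E(1) X] by blast
  obtain L where L: "linear L" "\<And>x. x \<in> E \<Longrightarrow> L x = S x"
    using linear_independent_extend[OF E(2), of S] by blast
  have LS: "L x = S x" if "x \<in> X" for x
  proof -
    have "x \<in> span E" using that spanE by simp
    then have "x \<in> X \<and> L x = S x"
    proof (induction rule: span_induct_alt)
      case base
      have "S 0 = 0 *\<^sub>R S 0"
        using lin subspace_0[OF X] unfolding linear_operator_on_def by (metis scaleR_zero_left)
      then show ?case using linear_0[OF L(1)] subspace_0[OF X] by simp
    next
      case (step c x y)
      then have "x \<in> X" using E(1) by blast
      with step show ?case
        using lin L X E(1) unfolding linear_operator_on_def
        by (simp add: linear_add linear_cmul subspace_add subspace_scale)
    qed
    then show ?thesis by blast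
  qed
  have "inj_on L (span E)"
    using inj LS unfolding spanE by (simp add: inj_on_def)
  then have ind: "independent (L ` E)"
    using linear_independent_injective_image[OF L(1) E(2)] by blast
  have card: "card (L ` E) = card E"
    using \<open>inj_on L (span E)\<close> by (intro card_image) (meson inj_on_subset span_superset)
  have "L ` E \<subseteq> X"
    using E(1) L(2) lin by (auto simp: linear_operator_on_def)
  show "X \<subseteq> S ` X"
  proof
    fix v assume v: "v \<in> X"
    have "v \<in> span (L ` E)"
    proof (rule ccontr)
      assume nv: "v \<notin> span (L ` E)"
      then have "independent (insert v (L ` E))"
        using ind real_vector.independent_insertI by blast
      then have "card (insert v (L ` E)) \<le> card E"
        using real_vector.independent_span_bound[OF \<open>finite E\<close>] v \<open>L ` E \<subseteq> X\<close> E(3) by blast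
      moreover have "v \<notin> L ` E" using nv span_superset by blast
      ultimately show False using card \<open>finite E\<close> by simp
    qed
    then have "v \<in> L ` X"
      using linear_span_image[OF L(1), of E] spanE by simp
    then show "v \<in> S ` X" using LS by auto
  qed
qed

text \<open>Serves both \<open>H G\<close> and \<open>V G\<close>. The grid sums are symmetric and
  bilinear for arbitrary functions; only definiteness is confined to the carrier, since functions
  living off the nodes have zero product with themselves.\<close>

locale finite_dim_inner_space =
  fixes X :: "'a::real_vector set" and ip :: "'a \<Rightarrow> 'a \<Rightarrow> real"
  assumes subspace: "subspace X"
    and finite_dim: "\<exists>T. finite T \<and> X \<subseteq> span T"
    and ip_commute: "ip x y = ip y x"
    and ip_add_left: "ip (x + y) z = ip x z + ip y z"
    and ip_scaleR_left: "ip (a *\<^sub>R x) z = a * ip x z"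
    and ip_pos: "x \<in> X \<Longrightarrow> x \<noteq> 0 \<Longrightarrow> 0 < ip x x"
begin

lemma ip_add_right: "ip z (x + y) = ip z x + ip z y"
  by (metis ip_add_left ip_commute)

lemma ip_scaleR_right: "ip z (a *\<^sub>R x) = a * ip z x"
  by (metis ip_scaleR_left ip_commute)

lemma ip_zero_left: "ip 0 x = 0"
  using ip_scaleR_left[of 0 0 x] by simp

lemma ip_diff_left: "ip (x - y) z = ip x z - ip y z"
  using ip_add_left[of "x - y" y z] by simp

lemma ip_diff_right: "ip z (x - y) = ip z x - ip z y"
  by (metis ip_diff_left ip_commute)

lemmas ip_simps = ip_add_left ip_add_right ip_scaleR_left ip_scaleR_right
  ip_diff_left ip_diff_right

lemma ip_nonneg: "x \<in> X \<Longrightarrow> 0 \<le> ip x x"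
  using ip_pos[of x] by (cases "x = 0") (auto simp: ip_zero_left less_imp_le)

text \<open>\<open>v - w\<close> is itself an admissible test vector, hence orthogonal to itself.
  Uniqueness and the algebra of adjoints rest on this.\<close>

lemma ip_ext:
  assumes "v \<in> X" "w \<in> X" "\<And>y. y \<in> X \<Longrightarrow> ip y v = ip y w"
  shows "v = w"
proof (rule ccontr)
  assume "v \<noteq> w"
  moreover have "v - w \<in> X" using assms subspace by (simp add: subspace_diff)
  ultimately show False
    using ip_pos[of "v - w"] assms(3)[of "v - w"] by (simp add: ip_diff_right)
qed

definition spd :: "('a \<Rightarrow> 'a) \<Rightarrow> bool"
  where "spd S \<longleftrightarrow> linear_operator_on X S \<and> self_adjoint_on X ip S \<and> positive_definite_on X ip S"

definition energy :: "('a \<Rightarrow> 'a) \<Rightarrow> 'a \<Rightarrow> real"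
  where "energy S x = sqrt (ip (S x) x)"

section \<open>Energy norm and inverse of a positive definite operator\<close>

context
  fixes S assumes S: "spd S"
begin

lemma spd_closed: "x \<in> X \<Longrightarrow> S x \<in> X"
  and spd_add: "x \<in> X \<Longrightarrow> y \<in> X \<Longrightarrow> S (x + y) = S x + S y"
  and spd_scaleR: "x \<in> X \<Longrightarrow> S (a *\<^sub>R x) = a *\<^sub>R S x"
  and spd_self_adjoint: "x \<in> X \<Longrightarrow> y \<in> X \<Longrightarrow> ip (S x) y = ip x (S y)"
  and spd_pos: "x \<in> X \<Longrightarrow> x \<noteq> 0 \<Longrightarrow> 0 < ip (S x) x"
  using S by (auto simp: spd_def linear_operator_on_def self_adjoint_on_def positive_definite_on_def)

lemma spd_diff: "x \<in> X \<Longrightarrow> y \<in> X \<Longrightarrow> S (x - y) = S x - S y"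
  using spd_add[of "x - y" y] subspace by (simp add: subspace_diff)

lemma spd_zero: "S 0 = 0"
  using spd_scaleR[of 0 0] subspace_0[OF subspace] by simp

lemma spd_nonneg: "x \<in> X \<Longrightarrow> 0 \<le> ip (S x) x"
  using spd_pos[of x] by (cases "x = 0") (auto simp: spd_zero ip_zero_left less_imp_le)

lemma energy_nonneg: "x \<in> X \<Longrightarrow> 0 \<le> energy S x"
  by (simp add: energy_def spd_nonneg)

lemma energy_power2: "x \<in> X \<Longrightarrow> (energy S x)\<^sup>2 = ip (S x) x"
  by (simp add: energy_def spd_nonneg)

lemma energy_eq_0_iff: "x \<in> X \<Longrightarrow> energy S x = 0 \<longleftrightarrow> x = 0"
  using spd_pos[of x] by (cases "x = 0") (auto simp: energy_def spd_zero ip_zero_left)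

lemma energy_scaleR: "x \<in> X \<Longrightarrow> energy S (a *\<^sub>R x) = \<bar>a\<bar> * energy S x"
  by (simp add: energy_def spd_scaleR ip_simps flip: mult.assoc)
    (simp add: real_sqrt_mult flip: power2_eq_square)

lemma energy_Cauchy_Schwarz:
  assumes x: "x \<in> X" and y: "y \<in> X"
  shows "ip (S x) y \<le> energy S x * energy S y"
proof (cases "y = 0")
  case True
  then show ?thesis
    by (simp add: ip_commute[of _ 0] ip_zero_left energy_def)
next
  case False
  define a where "a = ip (S y) y"
  define b where "b = ip (S x) y"
  have a: "a > 0" using spd_pos[OF y False] by (simp add: a_def)
  have sym: "ip (S y) x = b"
    using spd_self_adjoint[OF y x] by (simp add: b_def ip_commute)
  have yx: "a *\<^sub>R x \<in> X" "b *\<^sub>R y \<in> X"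
    using x y subspace by (auto simp: subspace_scale)
  \<comment> \<open>Up to the factor \<open>a\<close>, this vector is the part of \<open>x\<close>
    orthogonal to \<open>y\<close> in the form of \<open>S\<close>; scaling by \<open>a\<close>
    avoids a division.\<close>
  have "0 \<le> ip (S (a *\<^sub>R x - b *\<^sub>R y)) (a *\<^sub>R x - b *\<^sub>R y)"
    using spd_nonneg yx subspace by (simp add: subspace_diff)
  also have "\<dots> = a * (a * ip (S x) x - b\<^sup>2)"
    by (simp add: spd_diff yx spd_scaleR x y ip_simps sym flip: a_def b_def)
      (simp add: algebra_simps power2_eq_square)
  finally have "b\<^sup>2 \<le> a * ip (S x) x"
    using a by (simp add: zero_le_mult_iff)
  then have "\<bar>b\<bar> \<le> sqrt (a * ip (S x) x)"
    using real_le_rsqrt by simp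
  then show ?thesis
    by (simp add: energy_def real_sqrt_mult mult.commute flip: a_def b_def)
qed

lemma energy_triangle:
  assumes x: "x \<in> X" and y: "y \<in> X"
  shows "energy S (x + y) \<le> energy S x + energy S y"
proof (rule power2_le_imp_le)
  have xy: "x + y \<in> X" using x y subspace by (simp add: subspace_add)
  have "ip (S y) x = ip (S x) y"
    using spd_self_adjoint[OF y x] by (simp add: ip_commute)
  then have "(energy S (x + y))\<^sup>2 = (energy S x)\<^sup>2 + 2 * ip (S x) y + (energy S y)\<^sup>2"
    by (simp add: energy_power2 x y xy spd_add ip_simps)
  then show "(energy S (x + y))\<^sup>2 \<le> (energy S x + energy S y)\<^sup>2"
    using energy_Cauchy_Schwarz[OF x y] by (simp add: power2_sum)
  show "0 \<le> energy S x + energy S y"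
    by (simp add: energy_nonneg x y)
qed

lemma norm_on_energy: "norm_on X (energy S)"
  unfolding norm_on_def
  using energy_nonneg energy_eq_0_iff energy_scaleR energy_triangle by simp

lemma spd_inj_on: "inj_on S X"
proof (rule inj_onI, rule ccontr)
  fix x y assume xy: "x \<in> X" "y \<in> X" "S x = S y" "x \<noteq> y"
  then have "x - y \<in> X" using subspace by (simp add: subspace_diff)
  then show False
    using spd_pos[of "x - y"] xy by (simp add: spd_diff ip_zero_left)
qed

text \<open>Finite dimension enters here: definiteness gives injectivity and thereby surjectivity,
  so that \<open>inv_into X S\<close> is a two-sided inverse on \<open>X\<close>.\<close>

lemma spd_image: "S ` X = X"
  using finite_dim linear_operator_on_inj_imp_surj[OF subspace _ _ _ spd_inj_on] S
  by (auto simp: spd_def)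

lemma inverse_closed: "x \<in> X \<Longrightarrow> inv_into X S x \<in> X"
  using spd_image by (metis inv_into_into)

lemma inverse_right: "x \<in> X \<Longrightarrow> S (inv_into X S x) = x"
  using spd_image by (metis f_inv_into_f)

lemma inverse_left: "x \<in> X \<Longrightarrow> inv_into X S (S x) = x"
  using spd_inj_on by (rule inv_into_f_f)

text \<open>Each property is that of \<open>S\<close> at the preimages; for instance, with
  \<open>y\<close> the preimage of \<open>x\<close>, the form of the inverse at \<open>x\<close> is
  \<open>ip (S y) y\<close>.\<close>

lemma spd_inverse: "spd (inv_into X S)"
proof -
  let ?I = "inv_into X S"
  have add: "?I (x + y) = ?I x + ?I y" if "x \<in> X" "y \<in> X" for x y
    using that inverse_left[of "?I x + ?I y"] subspace
    by (simp add: inverse_closed inverse_right spd_add subspace_add)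
  have scaleR: "?I (a *\<^sub>R x) = a *\<^sub>R ?I x" if "x \<in> X" for a x
    using that inverse_left[of "a *\<^sub>R ?I x"] subspace
    by (simp add: inverse_closed inverse_right spd_scaleR subspace_scale)
  have adj: "ip (?I x) y = ip x (?I y)" if "x \<in> X" "y \<in> X" for x y
    using that spd_self_adjoint[of "?I x" "?I y"] by (simp add: inverse_closed inverse_right)
  have pos: "0 < ip (?I x) x" if "x \<in> X" "x \<noteq> 0" for x
  proof -
    have "?I x \<noteq> 0" using that inverse_right[of x] spd_zero by auto
    then show ?thesis
      using that spd_pos[of "?I x"] by (simp add: inverse_closed inverse_right ip_commute)
  qed
  show ?thesis
    using inverse_closed add scaleR adj pos
    by (simp add: spd_def linear_operator_on_def self_adjoint_on_def positive_definite_on_def)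
qed

text \<open>Duality of the two norms: Cauchy-Schwarz for the preimage of \<open>f\<close>, whose
  \<open>S\<close>-energy equals the energy of \<open>f\<close> under the inverse.\<close>

lemma ip_le_energy_inverse:
  assumes f: "f \<in> X" and y: "y \<in> X"
  shows "ip f y \<le> energy (inv_into X S) f * energy S y"
proof -
  have "energy S (inv_into X S f) = energy (inv_into X S) f"
    by (simp add: energy_def inverse_right f ip_commute)
  then show ?thesis
    using energy_Cauchy_Schwarz[of "inv_into X S f" y] f y
    by (simp add: inverse_closed inverse_right)
qed

end

text \<open>\<open>A\<close> stands for \<open>R\<close> applied to \<open>w + v\<close>; all the
  energy estimate uses of it is its sign against \<open>w + v\<close>.\<close>

lemma two_layer_stability:
  assumes S: "spd S" and v: "v \<in> X" and w: "w \<in> X" and f: "f \<in> X" and "0 \<le> \<tau>"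
    and eq: "S (w - v) + (\<tau> / 2) *\<^sub>R A = \<tau> *\<^sub>R f" and A: "0 \<le> ip A (w + v)"
  shows "energy S w \<le> energy S v + \<tau> * energy (inv_into X S) f"
proof -
  define c where "c = energy (inv_into X S) f"
  have c: "0 \<le> c"
    using energy_nonneg[OF spd_inverse[OF S] f] by (simp add: c_def)
  have wv: "w + v \<in> X" using v w subspace by (simp add: subspace_add)
  \<comment> \<open>Self-adjointness cancels the mixed terms, leaving a difference of
    squares.\<close>
  have "ip (S v) w = ip (S w) v"
    using spd_self_adjoint[OF S v w] by (simp add: ip_commute)
  then have "ip (S (w - v)) (w + v) = (energy S w)\<^sup>2 - (energy S v)\<^sup>2"
    by (simp add: spd_diff[OF S] v w ip_simps energy_power2[OF S])
  then have "(energy S w)\<^sup>2 - (energy S v)\<^sup>2 + \<tau> / 2 * ip A (w + v) = \<tau> * ip f (w + v)"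
    using arg_cong[OF eq, of "\<lambda>x. ip x (w + v)"] by (simp add: ip_add_left ip_scaleR_left)
  moreover have "0 \<le> \<tau> / 2 * ip A (w + v)"
    using A \<open>0 \<le> \<tau>\<close> by simp
  moreover have "\<tau> * ip f (w + v) \<le> \<tau> * (c * (energy S w + energy S v))"
  proof (rule mult_left_mono[OF _ \<open>0 \<le> \<tau>\<close>])
    show "ip f (w + v) \<le> c * (energy S w + energy S v)"
      using ip_le_energy_inverse[OF S f wv] energy_triangle[OF S w v] c
      by (smt (verit) c_def mult_left_mono)
  qed
  ultimately have
    "(energy S w - energy S v) * (energy S w + energy S v) \<le> (\<tau> * c) * (energy S w + energy S v)"
    by (simp add: algebra_simps power2_eq_square)
  \<comment> \<open>The common factor can be divided out only when positive. If it is zero, both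
    energies vanish and the claim is \<open>0 \<le> \<tau> * c\<close>.\<close>
  then have "energy S w - energy S v \<le> \<tau> * c" if "0 < energy S w + energy S v"
    using that by simp
  moreover have "0 \<le> \<tau> * c"
    using \<open>0 \<le> \<tau>\<close> c by simp
  ultimately show ?thesis
    using energy_nonneg[OF S v] energy_nonneg[OF S w] unfolding c_def by argo
qed

end


section \<open>The spaces of grid functions\<close>

lemma sum_fun_apply: "sum f A x = (\<Sum>i\<in>A. f i x)"
  for f :: "'i \<Rightarrow> 'a \<Rightarrow> 'b::comm_monoid_add"
  by (induction A rule: infinite_finite_induct) auto

lemma scaleR_fun_apply: "(a *\<^sub>R f) x = a *\<^sub>R f x"
  by (simp add: scaleR_fun_def)

definition node_delta :: "node \<Rightarrow> node \<Rightarrow> real"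
  where "node_delta x = (\<lambda>z. if z = x then 1 else 0)"

lemma functions_on_eq_sum_delta:
  assumes "finite S" "y \<in> functions_on S"
  shows "y = (\<Sum>x\<in>S. y x *\<^sub>R node_delta x)"
proof
  fix z
  have "(\<Sum>x\<in>S. y x *\<^sub>R node_delta x) z = (\<Sum>x\<in>S. if z = x then y x else 0)"
    by (auto simp: sum_fun_apply scaleR_fun_def node_delta_def intro!: sum.cong)
  also have "\<dots> = y z"
    using assms by (cases z) (simp add: functions_on_def)
  finally show "y z = (\<Sum>x\<in>S. y x *\<^sub>R node_delta x) z" ..
qed

lemma finite_subgrid: "finite (subgrid G c)"
  by (cases c) auto

lemma finite_interior_nodes: "finite (interior_nodes G)"
  by (simp add: interior_nodes_def)

lemma UNIV_component: "(UNIV :: component set) = {P1, M1, P2, M2}"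
  using component.exhaust by auto

text \<open>Merges the zero boundary values with the extension by zero, so that \<open>H G\<close>
  is treated like the component spaces.\<close>

lemma H_eq: "H G = functions_on (interior_nodes G)"
proof -
  have "interior_nodes G \<subseteq> nodes G"
    by (auto simp: interior_nodes_def nodes_def)
  then show ?thesis
    by (auto simp: H_def functions_on_def boundary_nodes_def)
qed

lemma inner_on_commute: "inner_on G S y w = inner_on G S w y"
  by (simp add: inner_on_def mult.commute)

lemma inner_on_add_left: "inner_on G S (y + z) w = inner_on G S y w + inner_on G S z w"
  by (simp add: inner_on_def algebra_simps sum.distrib)

lemma inner_on_scaleR_left: "inner_on G S (a *\<^sub>R y) w = a * inner_on G S y w"
  by (simp add: inner_on_def scaleR_fun_def sum_distrib_left mult.assoc)

lemma inner_V_commute: "inner_V G p q = inner_V G q p"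
  unfolding inner_V_def by (intro sum.cong inner_on_commute refl)

lemma inner_V_add_left: "inner_V G (p + r) q = inner_V G p q + inner_V G r q"
  by (simp add: inner_V_def inner_on_add_left)

lemma inner_V_scaleR_left: "inner_V G (a *\<^sub>R p) q = a * inner_V G p q"
  by (simp add: inner_V_def scaleR_fun_apply inner_on_scaleR_left distrib_left)

lemma subspace_functions_on: "subspace (functions_on S)"
  by (auto simp: subspace_def functions_on_def scaleR_fun_def)

section \<open>Linearity and ranges of the difference operators\<close>

lemma D_comp_add: "D_comp G c (y + z) = D_comp G c y + D_comp G c z"
  by (cases c) (auto simp: D_comp_def fun_eq_iff diff_divide_distrib add_divide_distrib)

lemma D_comp_scaleR: "D_comp G c (a *\<^sub>R y) = a *\<^sub>R D_comp G c y"
  by (cases c) (auto simp: D_comp_def fun_eq_iff scaleR_fun_def diff_divide_distrib algebra_simps)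

lemma D_add: "D G (y + z) = D G y + D G z"
  by (simp add: D_def D_comp_add fun_eq_iff)

lemma D_scaleR: "D G (a *\<^sub>R y) = a *\<^sub>R D G y"
  by (rule ext) (simp add: D_def D_comp_scaleR scaleR_fun_apply)

lemma D_comp_in: "D_comp G c y \<in> functions_on (subgrid G c)"
  by (simp add: functions_on_def D_comp_def)

lemma D_in_V: "D G y \<in> V G"
  by (simp add: V_def D_def D_comp_in)

lemma Q_in_V: "Q G q \<in> V G"
  by (simp add: V_def Q_def D_comp_in)

lemma R_in_V: "R G q \<in> V G"
  by (simp add: R_def D_in_V)

text \<open>Positive steps make the weight \<open>h1 G * h2 G\<close> positive, the source of
  definiteness and of the division in the representation of functionals.\<close>

locale positive_grid =
  fixes G :: grid
  assumes h1_pos: "0 < h1 G" and h2_pos: "0 < h2 G"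
begin

lemma inner_on_pos:
  assumes "finite S" "y \<in> functions_on S" "y \<noteq> 0"
  shows "0 < inner_on G S y y"
proof -
  obtain x where "y x \<noteq> 0" using assms(3) by (auto simp: fun_eq_iff)
  then have x: "x \<in> S" using assms(2) by (cases x) (auto simp: functions_on_def)
  have "0 < y x * y x * h1 G * h2 G"
    using \<open>y x \<noteq> 0\<close> h1_pos h2_pos by (simp flip: power2_eq_square)
  moreover have "0 \<le> y z * y z * h1 G * h2 G" for z
    using h1_pos h2_pos by simp
  ultimately show ?thesis
    unfolding inner_on_def by (rule sum_pos2[OF assms(1) x])
qed

lemma inner_on_nonneg: "0 \<le> inner_on G S y y"
  unfolding inner_on_def using h1_pos h2_pos by (intro sum_nonneg) simp

lemma finite_dim_inner_space_functions_on:
  assumes "finite S"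
  shows "finite_dim_inner_space (functions_on S) (inner_on G S)"
proof
  have "functions_on S \<subseteq> span (node_delta ` S)"
  proof
    fix y assume "y \<in> functions_on S"
    then have "y = (\<Sum>x\<in>S. y x *\<^sub>R node_delta x)"
      using functions_on_eq_sum_delta assms by blast
    also have "\<dots> \<in> span (node_delta ` S)"
      by (intro span_sum span_scale span_base) simp
    finally show "y \<in> span (node_delta ` S)" .
  qed
  then show "\<exists>T. finite T \<and> functions_on S \<subseteq> span T"
    using assms by blast
qed (use inner_on_commute inner_on_add_left inner_on_scaleR_left inner_on_pos[OF assms]
    subspace_functions_on in auto)

sublocale H: finite_dim_inner_space "H G" "inner_H G"
  unfolding H_eq inner_H_def
  by (rule finite_dim_inner_space_functions_on[OF finite_interior_nodes])

sublocale V: finite_dim_inner_space "V G" "inner_V G"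
proof
  show "subspace (V G)"
    by (auto simp: subspace_def V_def functions_on_def scaleR_fun_def)
  \<comment> \<open>Unit vectors of the direct sum: a nodal delta in one component and zero in the
    others.\<close>
  define e where "e = (\<lambda>(c :: component, x) c'. if c' = c then node_delta x else 0)"
  let ?I = "Sigma UNIV (subgrid G)"
  have fin: "finite ?I" by (auto simp: finite_subgrid UNIV_component)
  have "V G \<subseteq> span (e ` ?I)"
  proof
    fix q assume q: "q \<in> V G"
    have "q c = (\<Sum>p\<in>?I. q (fst p) (snd p) *\<^sub>R e p) c" for c
    proof -
      have "(\<Sum>p\<in>?I. q (fst p) (snd p) *\<^sub>R e p) c
          = (\<Sum>p\<in>?I. q (fst p) (snd p) *\<^sub>R (e p c))"
        by (simp add: sum_fun_apply scaleR_fun_def)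
      also have "\<dots> = (\<Sum>d\<in>UNIV. \<Sum>x\<in>subgrid G d. q d x *\<^sub>R (if c = d then node_delta x else 0))"
        by (subst sum.Sigma) (auto simp: finite_subgrid UNIV_component e_def intro!: sum.cong)
      also have "\<dots> = (\<Sum>d\<in>UNIV. if c = d then \<Sum>x\<in>subgrid G d. q d x *\<^sub>R node_delta x else 0)"
        by (intro sum.cong) auto
      also have "\<dots> = (\<Sum>x\<in>subgrid G c. q c x *\<^sub>R node_delta x)"
        by (subst sum.delta') (auto simp: UNIV_component intro: component.exhaust)
      also have "\<dots> = q c"
        using functions_on_eq_sum_delta[OF finite_subgrid] q by (simp add: V_def)
      finally show ?thesis ..
    qed
    then have "q = (\<Sum>p\<in>?I. q (fst p) (snd p) *\<^sub>R e p)" ..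
    also have "\<dots> \<in> span (e ` ?I)"
      by (intro span_sum span_scale span_base) simp
    finally show "q \<in> span (e ` ?I)" .
  qed
  then show "\<exists>T. finite T \<and> V G \<subseteq> span T"
    using fin by blast
next
  fix q assume q: "q \<in> V G" "q \<noteq> 0"
  then obtain c where "q c \<noteq> 0" by (auto simp: fun_eq_iff)
  then have "0 < inner_on G (subgrid G c) (q c) (q c)"
    using q by (intro inner_on_pos) (auto simp: finite_subgrid V_def)
  moreover have "c \<in> {P1, M1, P2, M2}" using UNIV_component by auto
  ultimately show "0 < inner_V G q q"
    unfolding inner_V_def using inner_on_nonneg by (intro sum_pos2) auto
qed (rule inner_V_commute inner_V_add_left inner_V_scaleR_left)+

lemma V_spd_eq: "V.spd = self_adjoint_pos_def G"
  by (simp add: fun_eq_iff V.spd_def self_adjoint_pos_def_def)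

lemma V_energy_eq: "V.energy = op_norm G"
  by (simp add: fun_eq_iff V.energy_def op_norm_def)

section \<open>Adjoints\<close>

text \<open>The Riesz theorem in coordinates; it supplies the existence of adjoints.\<close>

lemma functional_representation:
  assumes "finite S" and l: "linear l"
  shows "\<exists>w\<in>functions_on S. \<forall>y\<in>functions_on S. l y = inner_on G S y w"
proof
  \<comment> \<open>Testing with the nodal deltas forces these values; the division compensates the
    weight in the scalar product.\<close>
  define w where "w = (\<lambda>x. if x \<in> S then l (node_delta x) / (h1 G * h2 G) else 0)"
  show "w \<in> functions_on S" by (simp add: w_def functions_on_def)
  show "\<forall>y\<in>functions_on S. l y = inner_on G S y w"
  proof
    fix y assume "y \<in> functions_on S"
    then have "l y = l (\<Sum>x\<in>S. y x *\<^sub>R node_delta x)"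
      using functions_on_eq_sum_delta[OF assms(1)] by metis
    also have "\<dots> = (\<Sum>x\<in>S. y x * l (node_delta x))"
      using l by (simp add: linear_sum linear_cmul)
    also have "\<dots> = inner_on G S y w"
      using h1_pos h2_pos by (simp add: inner_on_def w_def)
    finally show "l y = inner_on G S y w" .
  qed
qed

text \<open>Makes the description operator meaningful: existence by representation, uniqueness by
  \<open>H.ip_ext\<close>. Leaving \<open>ipY\<close> and \<open>A\<close> general covers the
  component adjoints and \<open>D_adj\<close> alike.\<close>

lemma adjoint_on_H:
  assumes "linear (\<lambda>y. ipY (A y) q)"
  shows "adjoint_on (H G) (inner_H G) ipY A q \<in> H G"
    and "y \<in> H G \<Longrightarrow> ipY (A y) q = inner_H G y (adjoint_on (H G) (inner_H G) ipY A q)"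
proof -
  have ex1: "\<exists>!w. w \<in> H G \<and> (\<forall>y\<in>H G. ipY (A y) q = inner_H G y w)"
  proof (rule ex_ex1I)
    show "\<exists>w. w \<in> H G \<and> (\<forall>y\<in>H G. ipY (A y) q = inner_H G y w)"
      using functional_representation[OF finite_interior_nodes assms]
      unfolding H_eq inner_H_def by blast
  qed (metis H.ip_ext)
  have *: "adjoint_on (H G) (inner_H G) ipY A q \<in> H G \<and>
      (\<forall>y\<in>H G. ipY (A y) q = inner_H G y (adjoint_on (H G) (inner_H G) ipY A q))"
    unfolding adjoint_on_def by (rule theI'[OF ex1])
  show "adjoint_on (H G) (inner_H G) ipY A q \<in> H G"
    and "y \<in> H G \<Longrightarrow> ipY (A y) q = inner_H G y (adjoint_on (H G) (inner_H G) ipY A q)"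
    using * by simp_all
qed

lemma D_comp_adj_in_H: "D_comp_adj G c q \<in> H G"
  and inner_D_comp:
    "y \<in> H G \<Longrightarrow> inner_on G (subgrid G c) (D_comp G c y) q = inner_H G y (D_comp_adj G c q)"
proof -
  have "linear (\<lambda>y. inner_on G (subgrid G c) (D_comp G c y) q)"
    by (rule linearI) (simp_all add: D_comp_add D_comp_scaleR inner_on_add_left inner_on_scaleR_left)
  note adj = adjoint_on_H[of "inner_on G (subgrid G c)" "D_comp G c" q, OF this]
  show "D_comp_adj G c q \<in> H G"
    unfolding D_comp_adj_def by (rule adj(1))
  show "y \<in> H G \<Longrightarrow> inner_on G (subgrid G c) (D_comp G c y) q = inner_H G y (D_comp_adj G c q)"
    unfolding D_comp_adj_def by (rule adj(2))
qed

lemma D_adj_in_H: "D_adj G q \<in> H G"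
  and inner_D: "y \<in> H G \<Longrightarrow> inner_V G (D G y) q = inner_H G y (D_adj G q)"
proof -
  have "linear (\<lambda>y. inner_V G (D G y) q)"
    by (rule linearI) (simp_all add: D_add D_scaleR V.ip_add_left V.ip_scaleR_left)
  note adj = adjoint_on_H[of "inner_V G" "D G" q, OF this]
  show "D_adj G q \<in> H G"
    unfolding D_adj_def by (rule adj(1))
  show "y \<in> H G \<Longrightarrow> inner_V G (D G y) q = inner_H G y (D_adj G q)"
    unfolding D_adj_def by (rule adj(2))
qed

lemma D_comp_adj_add: "D_comp_adj G c (p + q) = D_comp_adj G c p + D_comp_adj G c q"
proof (rule H.ip_ext)
  fix y assume "y \<in> H G"
  then show "inner_H G y (D_comp_adj G c (p + q)) = inner_H G y (D_comp_adj G c p + D_comp_adj G c q)"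
    using inner_on_add_left[of G "subgrid G c" p q "D_comp G c y"]
    by (simp add: H.ip_add_right inner_on_commute flip: inner_D_comp)
qed (simp_all add: D_comp_adj_in_H H.subspace subspace_add)

lemma D_comp_adj_scaleR: "D_comp_adj G c (a *\<^sub>R q) = a *\<^sub>R D_comp_adj G c q"
proof (rule H.ip_ext)
  fix y assume "y \<in> H G"
  then show "inner_H G y (D_comp_adj G c (a *\<^sub>R q)) = inner_H G y (a *\<^sub>R D_comp_adj G c q)"
    using inner_on_scaleR_left[of G "subgrid G c" a q "D_comp G c y"]
    by (simp add: H.ip_scaleR_right inner_on_commute flip: inner_D_comp)
qed (simp_all add: D_comp_adj_in_H H.subspace subspace_scale)

text \<open>The scalar product of \<open>V G\<close> splits over the components, and each summand is
  moved to \<open>H G\<close> separately. This links \<open>R\<close> with its diagonal part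
  \<open>Q\<close>.\<close>

lemma D_adj_eq:
  "D_adj G q = D_comp_adj G P1 (q P1) + D_comp_adj G M1 (q M1)
    + D_comp_adj G P2 (q P2) + D_comp_adj G M2 (q M2)" (is "_ = ?s")
proof (rule H.ip_ext)
  fix y assume "y \<in> H G"
  then show "inner_H G y (D_adj G q) = inner_H G y ?s"
    by (simp add: H.ip_add_right inner_V_def D_def D_comp_adj_in_H del: subgrid.simps flip: inner_D inner_D_comp)
qed (simp_all add: D_adj_in_H D_comp_adj_in_H H.subspace subspace_add)

lemma D_adj_add: "D_adj G (p + q) = D_adj G p + D_adj G q"
  by (simp only: D_adj_eq plus_fun_apply D_comp_adj_add ac_simps)

lemma D_adj_scaleR: "D_adj G (a *\<^sub>R q) = a *\<^sub>R D_adj G q"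
  by (simp add: D_adj_eq scaleR_fun_apply D_comp_adj_scaleR scaleR_right_distrib)

section \<open>Quadratic forms of \<open>R\<close> and \<open>Q\<close>\<close>

lemma linear_R: "linear (R G)"
  by (rule linearI) (simp_all add: R_def D_adj_add D_adj_scaleR D_add D_scaleR)

lemma linear_Q: "linear (Q G)"
proof (rule linearI)
  show "Q G (p + q) = Q G p + Q G q" for p q
    by (rule ext) (simp add: Q_def D_comp_adj_add D_comp_add)
  show "Q G (a *\<^sub>R q) = a *\<^sub>R Q G q" for a q
    by (rule ext) (simp add: Q_def scaleR_fun_apply D_comp_adj_scaleR D_comp_scaleR)
qed

text \<open>Since \<open>R\<close> is \<open>D\<close> after its adjoint, its form is a Gram form in
  \<open>H G\<close>; symmetry and nonnegativity follow. The same holds for \<open>Q\<close>,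
  component by component.\<close>

lemma inner_R: "inner_V G (R G q) p = inner_H G (D_adj G q) (D_adj G p)"
  by (simp add: R_def inner_D D_adj_in_H)

lemma inner_Q:
  "inner_V G (Q G q) p =
    (\<Sum>c\<in>{P1, M1, P2, M2}. inner_H G (D_comp_adj G c (q c)) (D_comp_adj G c (p c)))"
  unfolding inner_V_def Q_def by (intro sum.cong refl inner_D_comp D_comp_adj_in_H)

lemma inner_R_nonneg: "0 \<le> inner_V G (R G q) q"
  by (simp add: inner_R H.ip_nonneg D_adj_in_H)

lemma inner_Q_nonneg: "0 \<le> inner_V G (Q G q) q"
  unfolding inner_Q by (intro sum_nonneg H.ip_nonneg D_comp_adj_in_H)

lemma inner_R_le_inner_Q: "inner_V G (R G q) q \<le> 4 * inner_V G (Q G q) q"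
proof -
  define a b c d where "a = D_comp_adj G P1 (q P1)" and "b = D_comp_adj G M1 (q M1)"
    and "c = D_comp_adj G P2 (q P2)" and "d = D_comp_adj G M2 (q M2)"
  note abcd = a_def b_def c_def d_def
  have "0 \<le> inner_H G (x - y) (x - y)" for x y
    by (simp add: inner_H_def inner_on_nonneg)
  then have le: "inner_H G x y + inner_H G y x \<le> inner_H G x x + inner_H G y y" for x y
    by (smt (verit) H.ip_diff_left H.ip_diff_right)
  have "inner_H G (a + b + c + d) (a + b + c + d)
    \<le> 4 * (inner_H G a a + inner_H G b b + inner_H G c c + inner_H G d d)"
    \<comment> \<open>Each vector lies in three of the six pairs; with its own square this makes the
      factor 4.\<close>
    using le[of a b] le[of a c] le[of a d] le[of b c] le[of b d] le[of c d]
    by (simp add: H.ip_add_left H.ip_add_right)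
  then show ?thesis
    by (simp add: inner_R inner_Q D_adj_eq abcd add.assoc)
qed

section \<open>The weighted scheme\<close>

lemma spd_B_op:
  assumes C: "V.spd C" and "0 < \<tau>" "2 \<le> \<sigma>"
  shows "V.spd (B_op G C \<sigma> \<tau>)"
  unfolding V.spd_def linear_operator_on_def self_adjoint_on_def positive_definite_on_def
proof (intro conjI ballI allI impI)
  fix p q assume p: "p \<in> V G" and q: "q \<in> V G"
  show "B_op G C \<sigma> \<tau> p \<in> V G"
    unfolding B_op_def
    by (intro subspace_add subspace_diff subspace_scale V.subspace V.spd_closed[OF C p] Q_in_V R_in_V)
  show "B_op G C \<sigma> \<tau> (p + q) = B_op G C \<sigma> \<tau> p + B_op G C \<sigma> \<tau> q"
    by (simp add: B_op_def V.spd_add[OF C p q] linear_add[OF linear_Q] linear_add[OF linear_R]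
        scaleR_right_distrib)
  show "B_op G C \<sigma> \<tau> (a *\<^sub>R p) = a *\<^sub>R B_op G C \<sigma> \<tau> p" for a
    by (simp add: B_op_def V.spd_scaleR[OF C p] linear_cmul[OF linear_Q] linear_cmul[OF linear_R]
        scaleR_right_distrib scaleR_right_diff_distrib mult.commute)
  \<comment> \<open>Moving \<open>p\<close> to the right argument turns both sides into Gram forms
    in \<open>H G\<close>, which are symmetric.\<close>
  have "inner_V G (Q G p) q = inner_V G p (Q G q)" "inner_V G (R G p) q = inner_V G p (R G q)"
    unfolding V.ip_commute[of p] inner_Q inner_R by (simp_all add: H.ip_commute)
  then show "inner_V G (B_op G C \<sigma> \<tau> p) q = inner_V G p (B_op G C \<sigma> \<tau> q)"
    by (simp add: B_op_def V.ip_simps V.spd_self_adjoint[OF C p q])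
next
  fix q assume q: "q \<in> V G" "q \<noteq> 0"
  let ?q = "inner_V G (Q G q) q" and ?r = "inner_V G (R G q) q"
  \<comment> \<open>The constant 4 times \<open>\<tau> / 2\<close> is \<open>2 * \<tau>\<close>,
    which \<open>\<sigma> * \<tau>\<close> dominates exactly when \<open>\<sigma> \<ge> 2\<close>.
    What remains of the form of \<open>B\<close> is at least that of \<open>C\<close>.\<close>
  have "\<tau> / 2 * ?r \<le> \<tau> / 2 * (4 * ?q)"
    using inner_R_le_inner_Q \<open>0 < \<tau>\<close> by (intro mult_left_mono) auto
  also have "\<dots> = 2 * \<tau> * ?q" by simp
  also have "\<dots> \<le> \<sigma> * \<tau> * ?q"
    using assms(2,3) inner_Q_nonneg by (intro mult_right_mono) auto
  finally show "0 < inner_V G (B_op G C \<sigma> \<tau> q) q"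
    using V.spd_pos[OF C q] by (simp add: B_op_def V.ip_simps)
qed

text \<open>After multiplication by \<open>\<tau>\<close>, the weighted \<open>Q\<close> term is
  \<open>\<sigma> * \<tau>\<close> times \<open>Q (w - v)\<close> plus \<open>\<tau>\<close> times
  \<open>Q v\<close>, and the latter cancels. The explicit term is split by
  \<open>2 v = (w + v) - (w - v)\<close>, whose second half completes \<open>B\<close>.\<close>

lemma scheme_canonical_form:
  assumes C: "V.spd C" and "\<tau> \<noteq> 0" and v: "v \<in> V G" and w: "w \<in> V G"
    and eq: "C ((1 / \<tau>) *\<^sub>R (w - v)) + Q G (\<sigma> *\<^sub>R w + (1 - \<sigma>) *\<^sub>R v) + (R G v - Q G v) = f"
  shows "B_op G C \<sigma> \<tau> (w - v) + (\<tau> / 2) *\<^sub>R R G (w + v) = \<tau> *\<^sub>R f"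
proof -
  have d: "w - v \<in> V G" using v w V.subspace by (simp add: subspace_diff)
  have f: "f = (1 / \<tau>) *\<^sub>R C (w - v) + (\<sigma> *\<^sub>R Q G w + (1 - \<sigma>) *\<^sub>R Q G v) + (R G v - Q G v)"
    by (simp only: V.spd_scaleR[OF C d] linear_add[OF linear_Q] linear_cmul[OF linear_Q] flip: eq)
  have B: "B_op G C \<sigma> \<tau> (w - v) = C (w - v) + (\<sigma> * \<tau>) *\<^sub>R (Q G w - Q G v) - (\<tau> / 2) *\<^sub>R (R G w - R G v)"
    by (simp only: B_op_def linear_diff[OF linear_Q] linear_diff[OF linear_R])
  show ?thesis
    unfolding f B linear_add[OF linear_R] using \<open>\<tau> \<noteq> 0\<close>
    by (intro ext) (simp add: scaleR_fun_apply field_simps)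
qed

end

theorem theorem3:
  fixes G :: grid
    and K :: "vector_function \<Rightarrow> vector_function"
    and u0 :: "node \<Rightarrow> real"
    and \<phi> :: "nat \<Rightarrow> node \<Rightarrow> real"
    and N :: nat
    and \<sigma> \<tau> :: real
  assumes "len1 G > 0" "len2 G > 0" "num1 G \<ge> 1" "num2 G \<ge> 1"
    and "self_adjoint_pos_def G K"
    and "u0 \<in> H G"
    and "N \<ge> 1"
    and "\<And>n. n < N \<Longrightarrow> \<phi> n \<in> H G"
    and "\<tau> > 0"
    and "\<sigma> \<ge> 2"
  defines "B \<equiv> B_op G (inverse_op G K) \<sigma> \<tau>"
  shows "self_adjoint_pos_def G B \<and>
    norm_on (V G) (op_norm G B) \<and>
    norm_on (V G) (op_norm G (inverse_op G B)) \<and>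
    (\<forall>g. scheme_solution G K \<sigma> \<tau> N u0 \<phi> g \<longrightarrow>
      (\<forall>n<N. op_norm G B (g (n + 1))
        \<le> op_norm G B (g n) + \<tau> * op_norm G (inverse_op G B) (D G (\<phi> n))))"
proof -
  interpret positive_grid G
    using assms(1-4) by unfold_locales (simp_all add: h1_def h2_def)
  have C: "V.spd (inverse_op G K)"
    unfolding inverse_op_def using assms(5) by (intro V.spd_inverse) (simp add: V_spd_eq)
  have B: "V.spd B"
    unfolding B_def using C assms(9,10) by (rule spd_B_op)
  have "op_norm G B (g (n + 1))
        \<le> op_norm G B (g n) + \<tau> * op_norm G (inverse_op G B) (D G (\<phi> n))"
    if g: "scheme_solution G K \<sigma> \<tau> N u0 \<phi> g" and n: "n < N" for g n
  proof -
    have gV: "g n \<in> V G" "g (n + 1) \<in> V G"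
      using g n by (simp_all add: scheme_solution_def)
    have "B (g (n + 1) - g n) + (\<tau> / 2) *\<^sub>R R G (g (n + 1) + g n) = \<tau> *\<^sub>R D G (\<phi> n)"
      unfolding B_def using g n assms(9)
      by (intro scheme_canonical_form C gV) (simp_all add: scheme_solution_def)
    \<comment> \<open>Here \<open>A\<close> is \<open>R\<close> applied to the sum of the two
      layers, so its sign condition is nonnegativity of the form of \<open>R\<close>.\<close>
    from V.two_layer_stability[OF B gV D_in_V _ this inner_R_nonneg] show ?thesis
      using assms(9) by (simp add: V_energy_eq inverse_op_def)
  qed
  then show ?thesis
    using B V.norm_on_energy[OF B] V.norm_on_energy[OF V.spd_inverse[OF B]]
    by (auto simp: V_spd_eq V_energy_eq inverse_op_def)
qed

end
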